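(* Let $p\in\mathbb{C}$, let $y_p(x)=\frac{e^{px}-1}{p}e^{-x}$ (with $y_0(x)=xe^{-x}$), and let $\gamma_p\in x+x^2\mathbb{C}[[x]]$ be the compositional inverse of $y_p$. Then, as formal power series, $$\ln\gamma_p'(x)=\sum_{n=1}^\infty\frac{x^n}{n}\sum_{k=0}^n\binom{\frac np}{k}p^k(1-p)^{n-k}.$$
   Context: For a complex number $z$, $\binom zk=\frac{z(z-1)\cdots(z-k+1)}{k!}$; the product $\binom{n/p}{k}p^k$ is read as $\frac1{k!}\prod_{j=0}^{k-1}(n-jp)$, which makes sense also for $p=0$. The convention $0^0=1$ is used. $\ln\gamma_p'$ is the formal logarithm of a power series with constant term $1$. *)

theory Defs
  imports Complex_Main "HOL-Computational_Algebra.Formal_Power_Series"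
begin

unbundle fps_syntax

definition y_fps :: "complex \<Rightarrow> complex fps" where
  "y_fps p = (if p = 0 then fps_X else fps_const (1 / p) * (fps_exp p - 1)) * fps_exp (- 1)"

definition gamma_fps :: "complex \<Rightarrow> complex fps" where
  "gamma_fps p = fps_inv (y_fps p)"

text \<open>
  Formal logarithm of a power series \<open>F\<close> with constant term 1 (junk otherwise):
  \<open>fps_ln 1\<close> is the series of \<open>ln (1 + x)\<close>, into which \<open>F - 1\<close> is substituted.
\<close>

definition fps_log :: "'a :: field_char_0 fps \<Rightarrow> 'a fps" where
  "fps_log F = fps_ln 1 oo (F - 1)"

text \<open>
  The product \<open>(n/p gchoose k) * p ^ k\<close>, read as a polynomial in \<open>p\<close>, so that \<open>p = 0\<close> is allowed;
  see \<open>binom_pow_eq_gbinomial\<close> below.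
\<close>

definition binom_pow :: "complex \<Rightarrow> nat \<Rightarrow> nat \<Rightarrow> complex" where
  "binom_pow p n k = (1 / fact k) * (\<Prod>j<k. of_nat n - of_nat j * p)"

lemma binom_pow_eq_gbinomial:
  assumes "p \<noteq> 0"
  shows "binom_pow p n k = ((of_nat n / p) gchoose k) * p ^ k"
proof -
  have "(\<Prod>j<k. of_nat n - of_nat j * p) = (\<Prod>j<k. (of_nat n / p - of_nat j) * p)"
    using assms by (intro prod.cong) (auto simp: field_simps)
  also have "\<dots> = (\<Prod>j<k. of_nat n / p - of_nat j) * p ^ k"
    by (simp add: prod.distrib)
  finally show ?thesis
    by (simp add: binom_pow_def gbinomial_prod_rev atLeast0LessThan)
qed

lemma y_fps_nth_0: "y_fps p $ 0 = 0"
  by (simp add: y_fps_def)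

lemma y_fps_nth_1: "y_fps p $ 1 = 1"
  by (simp add: y_fps_def fps_mult_nth)

lemma gamma_fps_nth_0: "gamma_fps p $ 0 = 0"
  by (simp add: gamma_fps_def fps_inv_def)

lemma gamma_fps_nth_1: "gamma_fps p $ 1 = 1"
  using y_fps_nth_1[of p] by (simp add: gamma_fps_def fps_inv_def)

lemma gamma_fps_oo_y_fps: "gamma_fps p oo y_fps p = fps_X"
  unfolding gamma_fps_def by (rule fps_inv) (use y_fps_nth_0 y_fps_nth_1 in auto)

lemma y_fps_oo_gamma_fps: "y_fps p oo gamma_fps p = fps_X"
  unfolding gamma_fps_def by (rule fps_inv_right) (use y_fps_nth_0 y_fps_nth_1 in auto)

lemma fps_deriv_gamma_fps_nth_0: "fps_deriv (gamma_fps p) $ 0 = 1"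
  using gamma_fps_nth_1[of p] by simp

end

(*
  Let E = (e^(p u) - 1)/p and take t = E(u) as the new variable, so that u = U(t) with
  (1 + p t) U' = 1. Put phi = e^U, so that phi = (1 + p t)^(1/p) and y = t / phi(t). The sum over
  k is the coefficient of t^n in R phi^n, where R = 1 / (1 - (1 - p) t). By the Lagrange inversion
  formula this is the coefficient of x^n in the series H with H(t/phi) (1 - t phi'/phi) = R, and
  differentiating gamma(t/phi) = U shows that H = 1 + x (ln gamma')'.
*)
theory Submission
  imports Defs
begin

lemma fps_log_nth_0: "fps_log F $ 0 = 0"
  by (simp add: fps_log_def fps_ln_def)

text \<open>Chain rule: the derivative of \<open>fps_ln 1\<close> is the inverse of
  \<open>1 + fps_X\<close>, and substituting \<open>F - 1\<close> turns this into
  \<open>inverse F\<close>. The form as a product is easy to compose with a further series.\<close>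

lemma fps_deriv_fps_log:
  fixes F :: "'a :: field_char_0 fps"
  assumes F0: "F $ 0 = 1"
  shows "fps_deriv (fps_log F) * F = fps_deriv F"
proof -
  have z: "(F - 1) $ 0 = 0" using F0 by simp
  have "inverse (1 + fps_X) oo (F - 1) = inverse ((1 + fps_X) oo (F - 1))"
    by (rule fps_inverse_compose[OF z]) simp
  also have "(1 + fps_X) oo (F - 1) = F"
    using z by (simp add: fps_compose_add_distrib)
  finally have "fps_deriv (fps_log F) = inverse F * fps_deriv F"
    using z by (simp add: fps_log_def fps_compose_deriv fps_ln_deriv)
  moreover have "inverse F * F = 1" using F0 by (simp add: inverse_mult_eq_1)
  ultimately show ?thesis by (metis mult.assoc mult.commute mult.right_neutral)
qed

lemma fps_deriv_power_log_deriv: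
  fixes \<phi> D :: "'a :: comm_semiring_1 fps"
  assumes D: "fps_deriv \<phi> = \<phi> * D"
  shows "fps_deriv (\<phi> ^ n) = of_nat n * D * \<phi> ^ n"
  by (induction n) (simp_all add: D algebra_simps)

text \<open>\<open>D\<close> is the logarithmic derivative of \<open>\<phi>\<close>. Multiplied by
  \<open>n\<close>, the series becomes \<open>n * f - fps_X * f'\<close> with
  \<open>f = \<phi> ^ n\<close>, and this operator annihilates the monomial of degree
  \<open>n\<close>.\<close>

lemma lagrange_base_coeff:
  fixes \<phi> D :: "'a :: field_char_0 fps"
  assumes D: "fps_deriv \<phi> = \<phi> * D" and n: "n > 0"
  shows "((1 - fps_X * D) * \<phi> ^ n) $ n = 0"
proof -
  have "fps_deriv (\<phi> ^ n) = of_nat n * D * \<phi> ^ n"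
    by (rule fps_deriv_power_log_deriv[OF D])
  then have "of_nat n * ((1 - fps_X * D) * \<phi> ^ n) = of_nat n * \<phi> ^ n - fps_X * fps_deriv (\<phi> ^ n)"
    by (simp add: algebra_simps)
  moreover have "(of_nat n * f - fps_X * fps_deriv f) $ n = 0" for f :: "'a fps"
    using n by (cases n) (simp_all add: fps_of_nat[symmetric] del: of_nat_Suc)
  moreover have "(of_nat n * ((1 - fps_X * D) * \<phi> ^ n)) $ n = of_nat n * ((1 - fps_X * D) * \<phi> ^ n) $ n"
    by (simp add: fps_of_nat[symmetric])
  ultimately show ?thesis using n by simp
qed

text \<open>Induction on \<open>n\<close> after splitting \<open>G\<close> into its constant term
  and \<open>fps_X * H\<close>. The constant contributes nothing by
  \<open>lagrange_base_coeff\<close>; in the rest one factor \<open>\<phi>\<close> cancels against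
  \<open>fps_X * inverse \<phi>\<close>, leaving the claim for \<open>H\<close> and
  \<open>n\<close>.\<close>

lemma fps_lagrange_inversion:
  fixes \<phi> D G :: "'a :: field_char_0 fps"
  assumes \<phi>0: "\<phi> $ 0 \<noteq> 0" and D: "fps_deriv \<phi> = \<phi> * D"
  shows "((G oo (fps_X * inverse \<phi>)) * (1 - fps_X * D) * \<phi> ^ n) $ n = G $ n"
proof (induction n arbitrary: G)
  case 0
  show ?case by simp
next
  case (Suc n)
  define a where "a = fps_X * inverse \<phi>"
  define H where "H = fps_shift 1 G"
  have a0: "a $ 0 = 0" by (simp add: a_def)
  have G: "G = fps_const (G $ 0) + fps_X * H"
    by (rule fps_ext) (simp add: H_def)
  have "G oo a = fps_const (G $ 0) + a * (H oo a)"
    by (subst G) (simp add: fps_compose_add_distrib fps_compose_mult_distrib[OF a0] a0)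
  moreover have "a * \<phi> ^ Suc n = fps_X * \<phi> ^ n"
  proof -
    have "a * \<phi> ^ Suc n = fps_X * (inverse \<phi> * \<phi>) * \<phi> ^ n"
      unfolding a_def power_Suc by (simp only: mult.assoc)
    then show ?thesis using \<phi>0 by (simp add: inverse_mult_eq_1)
  qed
  moreover have "(g + a * h) * b * f' = g * (b * f') + fps_X * (h * b * f)"
    if "a * f' = fps_X * f" for g h b f f' :: "'a fps"
    using that by algebra
  ultimately have "(G oo a) * (1 - fps_X * D) * \<phi> ^ Suc n =
      fps_const (G $ 0) * ((1 - fps_X * D) * \<phi> ^ Suc n)
        + fps_X * ((H oo a) * (1 - fps_X * D) * \<phi> ^ n)"
    by simp
  then have "((G oo a) * (1 - fps_X * D) * \<phi> ^ Suc n) $ Suc n =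
      G $ 0 * ((1 - fps_X * D) * \<phi> ^ Suc n) $ Suc n
        + ((H oo a) * (1 - fps_X * D) * \<phi> ^ n) $ n"
    by (simp del: power_Suc)
  also have "\<dots> = H $ n"
    using lagrange_base_coeff[OF D, of "Suc n"] Suc.IH[of H] by (simp add: a_def del: power_Suc)
  finally show ?case by (simp add: a_def H_def)
qed

text \<open>The differential equation characterises \<open>\<phi> = (1 + p t) powr (1 / p)\<close>, also for \<open>p = 0\<close>.\<close>

lemma binom_pow_eq_fps_nth_power:
  fixes \<phi> D :: "complex fps"
  assumes \<phi>0: "\<phi> $ 0 = 1" and D: "fps_deriv \<phi> = \<phi> * D"
    and D1: "(1 + fps_const p * fps_X) * D = 1"
  shows "(\<phi> ^ n) $ k = binom_pow p n k"
proof (induction k)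
  case 0
  show ?case using \<phi>0 by (simp add: binom_pow_def fps_nth_power_0)
next
  case (Suc k)
  have "(1 + fps_const p * fps_X) * fps_deriv (\<phi> ^ n) =
      ((1 + fps_const p * fps_X) * D) * (of_nat n * \<phi> ^ n)"
    unfolding fps_deriv_power_log_deriv[OF D] by (simp only: mult_ac)
  then have "(1 + fps_const p * fps_X) * fps_deriv (\<phi> ^ n) = of_nat n * \<phi> ^ n"
    unfolding D1 by simp
  then have "fps_deriv (\<phi> ^ n) + fps_const p * (fps_X * fps_deriv (\<phi> ^ n)) = fps_const (of_nat n) * \<phi> ^ n"
    by (simp add: fps_of_nat algebra_simps)
  then have "(fps_deriv (\<phi> ^ n) + fps_const p * (fps_X * fps_deriv (\<phi> ^ n))) $ k = of_nat n * (\<phi> ^ n) $ k"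
    by simp
  \<comment> \<open>Comparing coefficients in the differential equation gives the recurrence in
    \<open>k\<close> that \<open>binom_pow\<close> satisfies by its product form.\<close>
  then have "of_nat (Suc k) * (\<phi> ^ n) $ Suc k = (of_nat n - of_nat k * p) * (\<phi> ^ n) $ k"
    by (cases k) (simp_all add: algebra_simps)
  also have "\<dots> = of_nat (Suc k) * binom_pow p n (Suc k)"
    unfolding Suc.IH by (simp add: binom_pow_def field_simps del: of_nat_Suc)
  finally show ?case by (simp del: of_nat_Suc)
qed

text \<open>Since \<open>y_fps p\<close> is \<open>E\<close> times \<open>fps_exp (- 1)\<close>,
  substituting the inverse \<open>U\<close> of \<open>E\<close> yields
  \<open>fps_X * inverse \<phi>\<close>, which \<open>gamma_fps p\<close> must send back to
  \<open>U\<close>.\<close>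

lemma gamma_fps_parametrization:
  obtains U \<phi> :: "complex fps" where
    "(1 + fps_const p * fps_X) * fps_deriv U = 1"
    "\<phi> $ 0 = 1" "fps_deriv \<phi> = \<phi> * fps_deriv U"
    "gamma_fps p oo (fps_X * inverse \<phi>) = U"
proof -
  define E where "E = (if p = 0 then fps_X else fps_const (1 / p) * (fps_exp p - 1))"
  define U where "U = fps_inv E"
  define \<phi> where "\<phi> = fps_exp 1 oo U"
  have E0: "E $ 0 = 0" and E1: "E $ 1 = 1" by (auto simp: E_def)
  have U0: "U $ 0 = 0" by (simp add: U_def fps_inv_def)
  have EU: "E oo U = fps_X"
    unfolding U_def by (rule fps_inv_right) (use E0 E1 in auto)
  \<comment> \<open>This equation covers \<open>p = 0\<close> as well, so no later step
    distinguishes that case.\<close>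
  have E': "fps_deriv E = 1 + fps_const p * E"
    by (simp add: E_def mult.assoc[symmetric] fps_const_mult[symmetric] del: fps_const_mult)
       (simp add: algebra_simps)
  have "(fps_deriv E oo U) * fps_deriv U = 1"
    using fps_compose_deriv[OF U0, of E] by (simp add: EU)
  moreover have "fps_deriv E oo U = 1 + fps_const p * fps_X"
    by (simp add: E' fps_compose_add_distrib fps_compose_mult_distrib[OF U0] EU)
  ultimately have 1: "(1 + fps_const p * fps_X) * fps_deriv U = 1" by simp
  have 2: "\<phi> $ 0 = 1" by (simp add: \<phi>_def)
  have 3: "fps_deriv \<phi> = \<phi> * fps_deriv U"
    by (simp add: \<phi>_def fps_compose_deriv[OF U0])
  have "fps_exp (- 1) oo U = inverse \<phi>"
    unfolding \<phi>_def by (simp add: fps_exp_neg fps_inverse_compose[OF U0])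
  then have yU: "y_fps p oo U = fps_X * inverse \<phi>"
    unfolding y_fps_def E_def[symmetric] by (simp add: fps_compose_mult_distrib[OF U0] EU)
  have "gamma_fps p oo (y_fps p oo U) = U"
    using fps_compose_assoc[OF U0 y_fps_nth_0, of "gamma_fps p" p] U0
    by (simp add: gamma_fps_oo_y_fps)
  then have "gamma_fps p oo (fps_X * inverse \<phi>) = U" by (simp add: yU)
  with 1 2 3 show thesis by (rule that)
qed

lemma fps_log_deriv_gamma_coeff:
  "(1 + fps_X * fps_deriv (fps_log (fps_deriv (gamma_fps p)))) $ n =
    (\<Sum>k=0..n. binom_pow p n k * (1 - p) ^ (n - k))"
proof -
  obtain U \<phi> :: "complex fps" where U': "(1 + fps_const p * fps_X) * fps_deriv U = 1"
    and \<phi>0: "\<phi> $ 0 = 1" and \<phi>': "fps_deriv \<phi> = \<phi> * fps_deriv U"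
    and gU: "gamma_fps p oo (fps_X * inverse \<phi>) = U"
    by (rule gamma_fps_parametrization)
  define c where "c = fps_const (1 - p)"
  \<comment> \<open>The geometric series; for \<open>p = 1\<close> the convention
    \<open>0 ^ 0 = 1\<close> makes it the constant 1.\<close>
  define R where "R = Abs_fps (\<lambda>k. (1 - p) ^ k)"
  define x where "x = fps_X * inverse \<phi>"
  define L where "L = fps_log (fps_deriv (gamma_fps p))"
  define A where "A = fps_deriv (gamma_fps p) oo x"
  define M where "M = fps_deriv L oo x"
  have x0: "x $ 0 = 0" by (simp add: x_def)
  have inv: "\<phi> * inverse \<phi> = 1" using \<phi>0 by (simp add: inverse_mult_eq_1')
  have pc: "fps_const p = 1 - c" by (simp add: c_def fps_const_sub[symmetric] del: fps_const_sub)
  have R: "R * (1 - c * fps_X) = 1"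
  proof (rule fps_ext)
    fix k
    have "R * (1 - c * fps_X) = R - c * (fps_X * R)" by (simp add: algebra_simps)
    then show "(R * (1 - c * fps_X)) $ k = 1 $ k"
      by (cases k) (simp_all add: R_def c_def)
  qed
  have R': "fps_deriv R = c * R * R"
  proof -
    have "fps_deriv (R * (1 - c * fps_X)) = 0" unfolding R by simp
    then have "fps_deriv R * (1 - c * fps_X) = c * R"
      by (simp add: c_def algebra_simps)
    with R show ?thesis by algebra
  qed
  have x': "fps_deriv x = inverse \<phi> * (1 - fps_X * fps_deriv U)"
  proof -
    have "fps_deriv x = inverse \<phi> - fps_X * fps_deriv \<phi> * inverse \<phi> * inverse \<phi>"
      using \<phi>0 by (simp add: x_def fps_inverse_deriv power2_eq_square algebra_simps)
    with \<phi>' inv show ?thesis by algebra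
  qed
  have "A * fps_deriv x = fps_deriv U"
    using fps_compose_deriv[OF x0, of "gamma_fps p"] gU by (simp add: A_def x_def)
  then have "A * inverse \<phi> * (1 - fps_X * fps_deriv U) = fps_deriv U"
    unfolding x' by (simp only: mult.assoc)
  moreover have "(1 - fps_X * fps_deriv U) * (1 + fps_const p * fps_X) = 1 - c * fps_X"
    using U' unfolding pc by algebra
  ultimately have "A * inverse \<phi> * (1 - c * fps_X) = fps_deriv U * (1 + fps_const p * fps_X)"
    by (metis mult.assoc)
  also have "\<dots> = 1" using U' by (simp only: mult.commute)
  finally have "A * inverse \<phi> * (1 - c * fps_X) = 1" .
  \<comment> \<open>Thus \<open>gamma'\<close>, written in the new variable, is
    \<open>\<phi> * R\<close>, whose logarithmic derivative is found next.\<close>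
  then have A: "A = \<phi> * R" using inv R by algebra
  have "A $ 0 = 1" by (simp add: A \<phi>0 R_def)
  then have A_nz: "A \<noteq> 0" by auto
  have "(M * fps_deriv x) * A = fps_deriv A"
  proof -
    have "fps_deriv L * fps_deriv (gamma_fps p) = fps_deriv (fps_deriv (gamma_fps p))"
      unfolding L_def by (rule fps_deriv_fps_log) (rule fps_deriv_gamma_fps_nth_0)
    then have MA: "M * A = fps_deriv (fps_deriv (gamma_fps p)) oo x"
      unfolding M_def A_def by (simp add: fps_compose_mult_distrib[OF x0, symmetric])
    have "(M * fps_deriv x) * A = (M * A) * fps_deriv x" by (simp only: mult_ac)
    also have "\<dots> = fps_deriv A"
      unfolding MA unfolding A_def by (rule fps_compose_deriv[OF x0, symmetric])
    finally show ?thesis .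
  qed
  moreover have "fps_deriv A = (fps_deriv U + c * R) * A"
    unfolding A by (simp add: \<phi>' R' algebra_simps)
  ultimately have Mx: "M * fps_deriv x = fps_deriv U + c * R"
    using A_nz by simp
  have "(1 + fps_X * fps_deriv L) oo x = 1 + x * M"
    unfolding M_def
    by (simp add: fps_compose_add_distrib fps_compose_mult_distrib[OF x0] x0)
  \<comment> \<open>As \<open>x * (1 - fps_X * U') = fps_X * x'\<close>, the left side is
    \<open>1 - fps_X * U' + fps_X * (U' + c * R) = 1 + c * fps_X * R\<close>, which is
    \<open>R\<close>.\<close>
  then have HR: "((1 + fps_X * fps_deriv L) oo x) * (1 - fps_X * fps_deriv U) = R"
    using Mx x' R unfolding x_def by algebra
  have "(1 + fps_X * fps_deriv L) $ n = (\<phi> ^ n * R) $ n"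
    using fps_lagrange_inversion[OF _ \<phi>', of "1 + fps_X * fps_deriv L" n] \<phi>0 HR
    unfolding x_def by (simp add: mult.commute)
  \<comment> \<open>The sum is the Cauchy product of \<open>\<phi> ^ n\<close> with the geometric
    series.\<close>
  also have "\<dots> = (\<Sum>k=0..n. binom_pow p n k * (1 - p) ^ (n - k))"
    using binom_pow_eq_fps_nth_power[OF \<phi>0 \<phi>' U']
    by (simp add: fps_mult_nth R_def)
  finally show ?thesis unfolding L_def .
qed

theorem theorem4p3:
  fixes p :: complex
  shows "fps_log (fps_deriv (gamma_fps p)) =
    Abs_fps (\<lambda>n. if n = 0 then 0
      else (1 / of_nat n) * (\<Sum>k=0..n. binom_pow p n k * (1 - p) ^ (n - k)))"
proof (rule fps_ext)
  fix n
  show "fps_log (fps_deriv (gamma_fps p)) $ n =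
    Abs_fps (\<lambda>n. if n = 0 then 0
      else (1 / of_nat n) * (\<Sum>k=0..n. binom_pow p n k * (1 - p) ^ (n - k))) $ n"
  proof (cases n)
    case 0
    then show ?thesis by (simp add: fps_log_nth_0)
  next
    case (Suc m)
    \<comment> \<open>For positive \<open>n\<close> the summand 1 drops out, and
      \<open>fps_X\<close> times the derivative multiplies the coefficient of degree
      \<open>n\<close> by \<open>n\<close>.\<close>
    then show ?thesis
      using fps_log_deriv_gamma_coeff[of p n, symmetric] by (simp del: of_nat_Suc)
  qed
qed

end
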